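(* Let $c(\mathbf{u})=\tfrac12\mathbf{u}^T\mathbf{Q}\mathbf{u}$ on $\mathbb{R}^{2n}$ with $\mathbf{Q}\succ 0$ symmetric, and let $\boldsymbol\beta=(\beta_1,\dots,\beta_n)$ with all $\beta_i>0$ be fixed. Let $\mathbf{B}=[\mathbf{R}\ \ \mathbf{X}]\in\mathbb{R}^{n\times 2n}$ with rows $\mathbf{b}_i^T$, and let $\mathbf{e},\bar{\mathbf{x}}\in\mathbb{R}^n$. Then there exists a unique $\alpha\in\mathbb{R}^n$ with $\alpha_i\ge 0$ for all $i$ such that the augmented cost $$\tilde c(\mathbf{u}\mid\alpha,\mathbf{B})=c(\mathbf{u})+\sum_{i=1}^n\frac{\alpha_i}{\beta_i}e^{\beta_i(\mathbf{b}_i^T\mathbf{u}+e_i-\bar x_i)}$$ is strongly convex in $\mathbf{u}$ and its global minimizer $\mathbf{u}^*$ satisfies the optimality condition of the problem $$\min_{\mathbf{u}\in\mathbb{R}^{2n}} c(\mathbf{u})\quad\text{subject to}\quad \mathbf{B}\mathbf{u}+\mathbf{e}\le\bar{\mathbf{x}},$$ where $\alpha$ is chosen as follows: with $A=\{i:\mathbf{b}_i^T\mathbf{u}^*+e_i=\bar x_i\}$ the set of active constraints at $\mathbf{u}^*$, the vector $\alpha_A$ is given by the solution $(\mathbf{u},\alpha_A)$ of $$\begin{bmatrix}\mathbf{Q}&\mathbf{B}_A^T\\ \mathbf{B}_A&\mathbf{0}\end{bmatrix}\begin{bmatrix}\mathbf{u}\\ \alpha_A\end{bmatrix}=\begin{bmatrix}\mathbf{0}\\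 \bar{\mathbf{x}}_A-\mathbf{e}_A\end{bmatrix},$$ and $\alpha_j=0$ for $j\notin A$.
   Context: $N=\{1,\dots,n\}$ is the set of non-slack buses. $\mathbf{R},\mathbf{X}\in\mathbb{R}^{n\times n}$ are symmetric, positive definite matrices with all entries positive. For $A\subseteq N$, $\mathbf{B}_A$ is the submatrix of $\mathbf{B}$ with rows indexed by $A$, and $\alpha_A,\bar{\mathbf{x}}_A,\mathbf{e}_A$ are the corresponding subvectors. Inequalities between vectors are componentwise. The optimality condition of the problem at $\mathbf{u}^*$ is the first-order (Lagrange multiplier/KKT) condition: $\mathbf{u}^*$ is feasible and there exist multipliers $\mu_i\ge 0$, with $\mu_i=0$ for constraints inactive at $\mathbf{u}^*$, such that $\nabla c(\mathbf{u}^* )+\sum_{i}\mu_i\mathbf{b}_i=0$. *)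

theory Defs
  imports "HOL-Analysis.Analysis"
begin

definition positive_definite :: "real^'k^'k \<Rightarrow> bool" where
  "positive_definite M \<longleftrightarrow> (\<forall>x. x \<noteq> 0 \<longrightarrow> 0 < x \<bullet> (M *v x))"

definition strongly_convex :: "('a::real_normed_vector \<Rightarrow> real) \<Rightarrow> bool" where
  "strongly_convex f \<longleftrightarrow>
     (\<exists>m>0. \<forall>x y. \<forall>t\<in>{0..1}.
        f (t *\<^sub>R x + (1 - t) *\<^sub>R y)
          \<le> t * f x + (1 - t) * f y - m / 2 * t * (1 - t) * (norm (x - y))\<^sup>2)"

(* The n x 2n matrix [R X]; the 2n columns are indexed by the sum type 'n + 'n. *)
definition hcat :: "real^'n^'n \<Rightarrow> real^'n^'n \<Rightarrow> real^('n + 'n)^'n" where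
  "hcat R X = (\<chi> i k. case k of Inl j \<Rightarrow> R $ i $ j | Inr j \<Rightarrow> X $ i $ j)"

definition quadratic_cost :: "real^'k^'k \<Rightarrow> real^'k \<Rightarrow> real" where
  "quadratic_cost Q u = 1 / 2 * (u \<bullet> (Q *v u))"

definition augmented_cost ::
  "(real^'k \<Rightarrow> real) \<Rightarrow> real^'n \<Rightarrow> real^'k^'n \<Rightarrow> real^'n \<Rightarrow> real^'n \<Rightarrow> real^'n \<Rightarrow> real^'k \<Rightarrow> real"
  where
  "augmented_cost c \<beta> B e xbar \<alpha> u =
     c u + (\<Sum>i\<in>UNIV. \<alpha> $ i / \<beta> $ i * exp (\<beta> $ i * (row i B \<bullet> u + e $ i - xbar $ i)))"

definition active_set :: "real^'k^'n \<Rightarrow> real^'n \<Rightarrow> real^'n \<Rightarrow> real^'k \<Rightarrow> 'n set" where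
  "active_set B e xbar u = {i. row i B \<bullet> u + e $ i = xbar $ i}"

(* First-order (KKT) condition for minimizing c subject to B u + e <= xbar;
   the order on vectors is componentwise. *)
definition optimality_condition ::
  "(real^'k \<Rightarrow> real) \<Rightarrow> real^'k^'n \<Rightarrow> real^'n \<Rightarrow> real^'n \<Rightarrow> real^'k \<Rightarrow> bool" where
  "optimality_condition c B e xbar u \<longleftrightarrow>
     B *v u + e \<le> xbar \<and>
     (\<exists>g \<mu>. GDERIV c u :> g \<and>
        (\<forall>i. 0 \<le> \<mu> $ i) \<and>
        (\<forall>i. i \<notin> active_set B e xbar u \<longrightarrow> \<mu> $ i = 0) \<and>
        g + (\<Sum>i\<in>UNIV. \<mu> $ i *\<^sub>R row i B) = 0)"

(* The two block rows of the saddle-point system with matrix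
   [Q, B_A^T; B_A, 0] and right-hand side [0; xbar_A - e_A].  Only the
   components a $ i with i in A occur, so a stands for its subvector a_A. *)
definition saddle_point_system ::
  "real^'k^'k \<Rightarrow> real^'k^'n \<Rightarrow> real^'n \<Rightarrow> real^'n \<Rightarrow> 'n set \<Rightarrow> real^'k \<Rightarrow> real^'n \<Rightarrow> bool" where
  "saddle_point_system Q B e xbar A u a \<longleftrightarrow>
     Q *v u + (\<Sum>i\<in>A. a $ i *\<^sub>R row i B) = 0 \<and>
     (\<forall>i\<in>A. row i B \<bullet> u = xbar $ i - e $ i)"

definition exact_weights ::
  "(real^'k \<Rightarrow> real) \<Rightarrow> real^'n \<Rightarrow> real^'k^'n \<Rightarrow> real^'n \<Rightarrow> real^'n \<Rightarrow> real^'n \<Rightarrow> bool" where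
  "exact_weights c \<beta> B e xbar \<alpha> \<longleftrightarrow>
     (\<forall>i. 0 \<le> \<alpha> $ i) \<and>
     strongly_convex (augmented_cost c \<beta> B e xbar \<alpha>) \<and>
     (\<exists>u. is_arg_min (augmented_cost c \<beta> B e xbar \<alpha>) (\<lambda>_. True) u \<and>
          optimality_condition c B e xbar u)"

end

theory Submission
  imports Defs
begin

text \<open>
  At a point \<open>u\<close> the gradient of the augmented cost is \<open>Q u + B\<^sup>T w\<close>, where
  \<open>w\<^sub>i = \<alpha>\<^sub>i exp (\<beta>\<^sub>i s\<^sub>i)\<close> and \<open>s\<^sub>i\<close> is the violation of constraint \<open>i\<close>; the factor
  \<open>1 / \<beta>\<^sub>i\<close> in the cost is there to cancel the inner derivative. On an active constraint the
  exponential is \<open>1\<close>. Hence, if \<open>(u, \<mu>)\<close> is a pair of primal point and multipliers satisfying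
  the first-order conditions, the choice \<open>\<alpha> = \<mu>\<close> gives \<open>w = \<mu>\<close> at \<open>u\<close>: active
  components are unchanged and inactive ones vanish. So \<open>u\<close> is a stationary point of a strongly
  convex function, that is, its only minimizer (\<open>kkt_pair_minimizer\<close>).

  Conversely, let the minimizer \<open>u\<close> satisfy the first-order conditions with multipliers
  \<open>\<mu>\<close>. Then \<open>B\<^sup>T w = - Q u = B\<^sup>T \<mu>\<close>. The rows of \<open>[R X]\<close> are linearly independent
  because \<open>R\<close> is nonsingular, so \<open>w = \<mu>\<close>; and as the exponentials are nonzero
  on the inactive set and \<open>1\<close> on the active set, \<open>\<alpha> = \<mu>\<close>. Thus the exact weights are
  precisely the multipliers of the quadratic program (\<open>exact_weights_iff_kkt_pair\<close>), and
  everything is reduced to existence and uniqueness of the pair \<open>(u, \<mu>)\<close>.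

  Existence goes through the dual: eliminating \<open>u = - Q\<^sup>-\<^sup>1 B\<^sup>T \<mu>\<close> turns the conditions into
  a linear complementarity problem for \<open>M = B Q\<^sup>-\<^sup>1 B\<^sup>T\<close>, which is positive definite, and such a
  problem is solved by minimizing a quadratic over the nonnegative orthant
  (\<open>linear_complementarity_solution\<close>). Uniqueness is a monotonicity argument
  (\<open>stationary_pairs_coincide\<close>), which also yields unique solvability of the saddle point
  system on the active set.
\<close>

section \<open>Positive definite matrices\<close>

lemma positive_definite_inner_pos:
  "positive_definite M \<Longrightarrow> x \<noteq> 0 \<Longrightarrow> 0 < x \<bullet> (M *v x)"
  by (simp add: positive_definite_def)

lemma positive_definite_eq_0:
  "positive_definite M \<Longrightarrow> x \<bullet> (M *v x) \<le> 0 \<Longrightarrow> x = 0"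
  by (meson not_le positive_definite_inner_pos)

lemma inner_matrix_commute:
  fixes M :: "real^'k^'k"
  assumes "transpose M = M"
  shows "x \<bullet> (M *v y) = y \<bullet> (M *v x)"
  using assms by (metis dot_lmul_matrix inner_commute transpose_matrix_vector)

lemma inner_vector_matrix_mult:
  fixes B :: "real^'k^'n"
  shows "x \<bullet> (a v* B) = a \<bullet> (B *v x)"
  by (metis dot_lmul_matrix inner_commute)

text \<open>
  By homogeneity it is enough to bound the form below on the unit sphere, where compactness
  provides a minimum, which is positive.
\<close>
lemma positive_definite_coercive:
  fixes M :: "real^'k^'k"
  assumes "positive_definite M"
  obtains m where "0 < m" "\<And>x. m * (norm x)\<^sup>2 \<le> x \<bullet> (M *v x)"
proof -
  let ?f = "\<lambda>x::real^'k. x \<bullet> (M *v x)"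
  have "continuous_on (sphere 0 1) ?f"
    by (intro continuous_intros matrix_vector_mult_linear_continuous_on)
  moreover have "sphere (0::real^'k) 1 \<noteq> {}" by simp
  ultimately obtain z where z: "z \<in> sphere 0 1" "\<And>y. y \<in> sphere 0 1 \<Longrightarrow> ?f z \<le> ?f y"
    using continuous_attains_inf[of "sphere (0::real^'k) 1" ?f] by auto
  have "z \<noteq> 0" using z by auto
  then have pos: "0 < ?f z" using assms by (simp add: positive_definite_def)
  have "?f z * (norm x)\<^sup>2 \<le> ?f x" for x
  proof (cases "x = 0")
    case False
    then have "?f z \<le> ?f ((1 / norm x) *\<^sub>R x)" by (intro z) simp
    also have "\<dots> = ?f x / (norm x)\<^sup>2"
      by (simp add: matrix_vector_mult_scaleR power2_eq_square)
    finally show ?thesis using False by (simp add: field_simps)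
  qed simp
  with pos show thesis using that by blast
qed

section \<open>The linear complementarity problem\<close>

lemma quadratic_cost_expansion:
  fixes M :: "real^'k^'k"
  assumes "transpose M = M"
  shows "quadratic_cost M (x + h) =
    quadratic_cost M x + (M *v x) \<bullet> h + 1 / 2 * (h \<bullet> (M *v h))"
  using inner_matrix_commute[OF assms, of x h]
  by (simp add: quadratic_cost_def matrix_vector_right_distrib inner_add_left inner_add_right
      inner_commute field_simps)

lemma continuous_on_quadratic_cost: "continuous_on S (quadratic_cost M)"
  unfolding quadratic_cost_def
  by (intro continuous_intros matrix_vector_mult_linear_continuous_on)

text \<open>
  The inequality \<open>d \<le> M l\<close> and the complementary slackness are the first-order conditions for
  minimizing \<open>x \<bullet> M x / 2 - x \<bullet> d\<close> over the nonnegative orthant. A minimizer exists because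
  the objective is nonnegative, hence at least its value at the origin, outside a large ball.
\<close>
lemma linear_complementarity_solution:
  fixes M :: "real^'n^'n" and d :: "real^'n"
  assumes sym: "transpose M = M" and pd: "positive_definite M"
  obtains l where "0 \<le> l" "d \<le> M *v l" "\<And>i. l $ i = 0 \<or> (M *v l) $ i = d $ i"
proof -
  define q where "q x = quadratic_cost M x - x \<bullet> d" for x
  obtain m where m: "0 < m" "\<And>x. m * (norm x)\<^sup>2 \<le> x \<bullet> (M *v x)"
    using positive_definite_coercive[OF pd] by metis
  \<comment> \<open>Beyond this radius the quadratic term dominates the linear one.\<close>
  define r where "r = 2 * norm d / m"
  have r0: "0 \<le> r" using m by (simp add: r_def)
  let ?K = "{x::real^'n. 0 \<le> x} \<inter> cball 0 r"
  have "closed {x::real^'n. 0 \<le> x}"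
    unfolding less_eq_vec_def
    by (intro closed_Collect_all closed_Collect_le continuous_intros)
  then have "compact ?K" by (intro closed_Int_compact) auto
  moreover have zero: "0 \<in> ?K" using r0 by simp
  moreover have "continuous_on ?K q"
    unfolding q_def by (intro continuous_intros continuous_on_quadratic_cost)
  ultimately obtain l where l: "l \<in> ?K" "\<And>y. y \<in> ?K \<Longrightarrow> q l \<le> q y"
    using continuous_attains_inf[of ?K q] by blast
  have far: "0 \<le> q y" if "r < norm y" for y
  proof -
    have "norm d \<le> m / 2 * norm y" using that m by (simp add: r_def field_simps)
    then have "norm y * norm d \<le> norm y * (m / 2 * norm y)"
      by (intro mult_left_mono) auto
    also have "\<dots> = m * (norm y)\<^sup>2 / 2" by (simp add: power2_eq_square)
    also have "\<dots> \<le> quadratic_cost M y" using m(2)[of y] by (simp add: quadratic_cost_def)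
    finally show ?thesis using norm_cauchy_schwarz[of y d] by (simp add: q_def)
  qed
  have "q l \<le> 0" using l(2)[OF zero] by (simp add: q_def quadratic_cost_def)
  then have lmin: "q l \<le> q y" if "0 \<le> y" for y
    using that l(2)[of y] far[of y] by (cases "norm y \<le> r") auto
  have l0: "0 \<le> l" using l by auto
  define g where "g = M *v l - d"
  \<comment> \<open>Variational inequality: the directional derivatives towards the points of the orthant,
    which is convex, are nonnegative at the minimizer.\<close>
  have vi: "0 \<le> g \<bullet> (y - l)" if y: "0 \<le> y" for y
  proof (rule ccontr)
    let ?k = "(y - l) \<bullet> (M *v (y - l))"
    assume "\<not> 0 \<le> g \<bullet> (y - l)"
    then have neg: "g \<bullet> (y - l) < 0" by simp
    have step: "0 \<le> g \<bullet> (y - l) + t / 2 * ?k" if t: "0 < t" "t \<le> 1" for t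
    proof -
      have "0 \<le> l + t *\<^sub>R (y - l)"
      proof -
        have "l + t *\<^sub>R (y - l) = (1 - t) *\<^sub>R l + t *\<^sub>R y" by (simp add: algebra_simps)
        also have "0 \<le> \<dots>" using t l0 y by (intro add_nonneg_nonneg scaleR_nonneg_nonneg) auto
        finally show ?thesis .
      qed
      then have "q l \<le> q (l + t *\<^sub>R (y - l))" by (rule lmin)
      also have "\<dots> = q l + t * (g \<bullet> (y - l) + t / 2 * ?k)"
        unfolding q_def quadratic_cost_expansion[OF sym] g_def
        by (simp add: matrix_vector_mult_scaleR inner_commute[of d] inner_diff_left
            inner_add_left inner_diff_right algebra_simps)
      finally show ?thesis using t by (simp add: zero_le_mult_iff)
    qed
    have "((\<lambda>t. g \<bullet> (y - l) + t / 2 * ?k) \<longlongrightarrow> g \<bullet> (y - l) + 0 / 2 * ?k) (at_right 0)"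
      by (intro tendsto_intros) simp
    moreover have "eventually (\<lambda>t. 0 \<le> g \<bullet> (y - l) + t / 2 * ?k) (at_right 0)"
      unfolding eventually_at_right_field using step by (intro exI[of _ 1]) auto
    ultimately have "0 \<le> g \<bullet> (y - l) + 0 / 2 * ?k"
      by (intro tendsto_lowerbound[of _ _ "at_right 0"]) auto
    with neg show False by simp
  qed
  \<comment> \<open>Moving from \<open>l\<close> along a coordinate axis shows that the gradient is nonnegative; moving
    towards the origin then forces each product \<open>g\<^sub>i l\<^sub>i\<close> to vanish.\<close>
  have g0: "0 \<le> g $ i" for i
  proof -
    have "0 \<le> l + axis i 1" using l0 by (auto simp: less_eq_vec_def axis_def)
    from vi[OF this] show ?thesis by (simp add: inner_axis)
  qed
  have "(\<Sum>i\<in>UNIV. g $ i * l $ i) \<le> 0"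
    using vi[of 0] by (simp add: inner_vec_def sum_negf)
  moreover have nn: "0 \<le> g $ i * l $ i" for i using g0 l0 by (simp add: less_eq_vec_def)
  ultimately have "(\<Sum>i\<in>UNIV. g $ i * l $ i) = 0" by (meson order_antisym sum_nonneg)
  then have "g $ i * l $ i = 0" for i using nn by (simp add: sum_nonneg_eq_0_iff)
  then have "\<And>i. l $ i = 0 \<or> (M *v l) $ i = d $ i" by (auto simp: g_def)
  moreover have "d \<le> M *v l" using g0 by (simp add: g_def less_eq_vec_def)
  ultimately show thesis using that l0 by blast
qed

section \<open>Karush-Kuhn-Tucker pairs\<close>

text \<open>
  The optimality condition hides the multipliers behind an existential quantifier; they are exposed
  here because they turn out to be the weights sought. The product \<open>\<mu> v* B\<close> is the combination
  of the rows of \<open>B\<close> with coefficients \<open>\<mu>\<close>, that is \<open>B\<^sup>T \<mu>\<close>; accordingly, the assumption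
  \<open>a v* B = 0 \<Longrightarrow> a = 0\<close> below says that the rows of \<open>B\<close> are linearly independent.
\<close>
definition kkt_pair ::
  "real^'k^'k \<Rightarrow> real^'k^'n \<Rightarrow> real^'n \<Rightarrow> real^'n \<Rightarrow> real^'k \<Rightarrow> real^'n \<Rightarrow> bool" where
  "kkt_pair Q B e xbar u \<mu> \<longleftrightarrow>
     Q *v u + \<mu> v* B = 0 \<and> B *v u + e \<le> xbar \<and> 0 \<le> \<mu> \<and>
     (\<forall>i. i \<notin> active_set B e xbar u \<longrightarrow> \<mu> $ i = 0)"

lemma row_inner: "row i B \<bullet> u = (B *v u) $ i" for B :: "real^'k^'n"
  by (simp add: row_def matrix_vector_mul_component)

lemma vector_matrix_mult_eq_sum_rows:
  fixes B :: "real^'k^'n"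
  shows "a v* B = (\<Sum>i\<in>UNIV. a $ i *\<^sub>R row i B)"
  unfolding transpose_matrix_vector[symmetric] matrix_mult_sum
  by (simp add: scalar_mult_eq_scaleR)

text \<open>
  Solving stationarity for \<open>u = - Q\<^sup>-\<^sup>1 B\<^sup>T \<mu>\<close> leaves feasibility, sign and complementarity
  conditions on \<open>\<mu>\<close>: the linear complementarity problem for \<open>B Q\<^sup>-\<^sup>1 B\<^sup>T\<close> and
  \<open>e - xbar\<close>. Independence of the rows of \<open>B\<close> makes that matrix positive definite.
\<close>
lemma kkt_pair_exists:
  fixes Q :: "real^'k^'k" and B :: "real^'k^'n"
  assumes sym: "transpose Q = Q" and pd: "positive_definite Q"
    and ind: "\<And>a. a v* B = 0 \<Longrightarrow> a = 0"
  obtains u \<mu> where "kkt_pair Q B e xbar u \<mu>"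
proof -
  have "\<forall>x. Q *v x = 0 \<longrightarrow> x = 0" using pd by (auto intro: positive_definite_eq_0)
  then obtain P where PQ: "P ** Q = mat 1" using matrix_left_invertible_ker[of Q] by metis
  then have QP: "Q ** P = mat 1" by (simp add: matrix_left_right_inverse)
  have QPv: "Q *v (P *v x) = x" for x by (simp add: matrix_vector_mul_assoc QP)
  have symP: "transpose P = P"
  proof -
    have "transpose P ** Q = mat 1"
      by (metis QP matrix_transpose_mul sym transpose_mat)
    then have "transpose P ** (Q ** P) = P" by (simp add: matrix_mul_assoc)
    then show ?thesis by (simp add: QP)
  qed
  define M where "M = B ** P ** transpose B"
  have Mv: "M *v a = B *v (P *v (a v* B))" for a
    by (simp add: M_def flip: matrix_vector_mul_assoc)
  have "transpose M = M"
    by (simp add: M_def matrix_transpose_mul symP matrix_mul_assoc)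
  moreover have "positive_definite M"
    unfolding positive_definite_def
  proof (intro allI impI)
    fix a :: "real^'n"
    assume "a \<noteq> 0"
    \<comment> \<open>With \<open>w = P B\<^sup>T a\<close>, the value of the form at \<open>a\<close> is \<open>w \<bullet> Q w\<close>.\<close>
    let ?w = "P *v (a v* B)"
    have "?w \<noteq> 0" using \<open>a \<noteq> 0\<close> ind QPv by (metis matrix_vector_mult_0_right)
    then have "0 < ?w \<bullet> (Q *v ?w)" by (rule positive_definite_inner_pos[OF pd])
    then show "0 < a \<bullet> (M *v a)" by (simp add: QPv Mv inner_vector_matrix_mult)
  qed
  ultimately obtain l where l: "0 \<le> l" "e - xbar \<le> M *v l"
      "\<And>i. l $ i = 0 \<or> (M *v l) $ i = (e - xbar) $ i"
    using linear_complementarity_solution by metis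
  define u where "u = - (P *v (l v* B))"
  have Bu: "B *v u = - (M *v l)"
    by (simp add: u_def Mv linear_neg[OF matrix_vector_mul_linear])
  have "kkt_pair Q B e xbar u l"
    unfolding kkt_pair_def
  proof (intro conjI allI impI)
    show "Q *v u + l v* B = 0" by (simp add: u_def linear_neg[OF matrix_vector_mul_linear] QPv)
    show "B *v u + e \<le> xbar" using l(2) by (auto simp: Bu less_eq_vec_def algebra_simps)
    show "0 \<le> l" by fact
    show "l $ i = 0" if "i \<notin> active_set B e xbar u" for i
      using that l(3)[of i] by (auto simp: active_set_def row_inner Bu)
  qed
  then show thesis by (rule that)
qed

text \<open>
  Subtracting the two equations and pairing with \<open>u - u'\<close> gives
  \<open>(u - u') \<bullet> Q (u - u') = - \<Sum>\<^sub>i (a\<^sub>i - a'\<^sub>i) (b\<^sub>i \<bullet> u - b\<^sub>i \<bullet> u')\<close>, so under the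
  monotonicity hypothesis \<open>u = u'\<close>, and then the combinations of rows agree as well. It
  is applied with three sources of monotonicity: complementary slackness, equality constraints, and
  the trivial case \<open>u = u'\<close>.
\<close>
lemma stationary_pairs_coincide:
  fixes Q :: "real^'k^'k" and B :: "real^'k^'n"
  assumes pd: "positive_definite Q" and ind: "\<And>a. a v* B = 0 \<Longrightarrow> a = 0"
    and st: "Q *v u + a v* B = 0" "Q *v u' + a' v* B = 0"
    and mono: "\<And>i. 0 \<le> (a $ i - a' $ i) * (row i B \<bullet> u - row i B \<bullet> u')"
  shows "u = u' \<and> a = a'"
proof -
  have diff: "Q *v (u - u') = - ((a - a') v* B)"
    using st by (simp add: matrix_vector_mult_diff_distrib vector_matrix_mult_diff_distrib
        add_eq_0_iff)
  have "(u - u') \<bullet> (Q *v (u - u')) = - ((a - a') \<bullet> (B *v (u - u')))"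
    by (simp add: diff inner_vector_matrix_mult)
  also have "\<dots> \<le> 0"
    using mono unfolding row_inner
    by (auto simp: inner_vec_def matrix_vector_mult_diff_distrib intro!: sum_nonneg)
  finally have "u - u' = 0" by (rule positive_definite_eq_0[OF pd])
  then show ?thesis using diff ind[of "a - a'"] by simp
qed

text \<open>
  A positive multiplier \<open>a\<^sub>i\<close> means that \<open>u\<close> attains the bound in constraint \<open>i\<close>, which
  \<open>u'\<close> does not exceed; and symmetrically. This is the monotonicity needed for
  \<open>stationary_pairs_coincide\<close>.
\<close>
lemma kkt_pair_unique:
  fixes Q :: "real^'k^'k" and B :: "real^'k^'n"
  assumes pd: "positive_definite Q" and ind: "\<And>a. a v* B = 0 \<Longrightarrow> a = 0"
    and k: "kkt_pair Q B e xbar u a" "kkt_pair Q B e xbar u' a'"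
  shows "u = u' \<and> a = a'"
proof (rule stationary_pairs_coincide[OF pd ind])
  fix i
  have f: "row i B \<bullet> u + e $ i \<le> xbar $ i" "row i B \<bullet> u' + e $ i \<le> xbar $ i"
    using k by (auto simp: kkt_pair_def less_eq_vec_def row_inner)
  have n: "0 \<le> a $ i" "0 \<le> a' $ i" using k by (auto simp: kkt_pair_def less_eq_vec_def)
  have c: "a $ i = 0 \<or> row i B \<bullet> u + e $ i = xbar $ i"
      "a' $ i = 0 \<or> row i B \<bullet> u' + e $ i = xbar $ i"
    using k by (auto simp: kkt_pair_def active_set_def)
  have "0 \<le> a $ i * (row i B \<bullet> u - row i B \<bullet> u')"
    using c(1) f n by (cases "a $ i = 0") (auto intro!: mult_nonneg_nonneg)
  moreover have "0 \<le> a' $ i * (row i B \<bullet> u' - row i B \<bullet> u)"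
    using c(2) f n by (cases "a' $ i = 0") (auto intro!: mult_nonneg_nonneg)
  ultimately show "0 \<le> (a $ i - a' $ i) * (row i B \<bullet> u - row i B \<bullet> u')"
    by (simp add: algebra_simps)
qed (use k in \<open>auto simp: kkt_pair_def\<close>)

text \<open>
  In the saddle point system the constraints in \<open>A\<close> hold with equality and those outside are
  absent. After extending the coefficients by zero outside \<open>A\<close>, every summand in the monotonicity
  hypothesis of \<open>stationary_pairs_coincide\<close> is zero.
\<close>
lemma kkt_pair_saddle_point:
  fixes Q :: "real^'k^'k" and B :: "real^'k^'n"
  assumes pd: "positive_definite Q" and ind: "\<And>a. a v* B = 0 \<Longrightarrow> a = 0"
    and k: "kkt_pair Q B e xbar u \<mu>" and A: "A = active_set B e xbar u"
  shows "saddle_point_system Q B e xbar A v a \<longleftrightarrow> v = u \<and> (\<forall>i\<in>A. a $ i = \<mu> $ i)"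
proof -
  define trunc where "trunc a = (\<chi> i. if i \<in> A then a $ i else 0)" for a :: "real^'n"
  have tr: "(\<Sum>i\<in>A. a $ i *\<^sub>R row i B) = trunc a v* B" for a
    by (simp add: vector_matrix_mult_eq_sum_rows trunc_def if_distrib if_distribR sum.If_cases
        cong: if_cong)
  have mu: "trunc \<mu> = \<mu>" using k by (auto simp: trunc_def vec_eq_iff kkt_pair_def A)
  have act: "row i B \<bullet> u = xbar $ i - e $ i" if "i \<in> A" for i
    using that by (auto simp: A active_set_def)
  have st: "Q *v u + trunc \<mu> v* B = 0" using k by (simp add: mu kkt_pair_def)
  show ?thesis
  proof
    assume s: "saddle_point_system Q B e xbar A v a"
    have "v = u \<and> trunc a = trunc \<mu>"
    proof (rule stationary_pairs_coincide[OF pd ind])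
      show "Q *v v + trunc a v* B = 0"
        using s by (simp add: saddle_point_system_def tr)
      show "Q *v u + trunc \<mu> v* B = 0" by (fact st)
      show "0 \<le> (trunc a $ i - trunc \<mu> $ i) * (row i B \<bullet> v - row i B \<bullet> u)" for i
        using s by (cases "i \<in> A") (auto simp: act saddle_point_system_def trunc_def)
    qed
    then show "v = u \<and> (\<forall>i\<in>A. a $ i = \<mu> $ i)" by (auto simp: trunc_def vec_eq_iff split: if_splits)
  next
    assume "v = u \<and> (\<forall>i\<in>A. a $ i = \<mu> $ i)"
    moreover from this have "trunc a = trunc \<mu>" by (simp add: trunc_def vec_eq_iff)
    ultimately show "saddle_point_system Q B e xbar A v a"
      using st act by (simp add: saddle_point_system_def tr)
  qed
qed

lemma GDERIV_quadratic_cost: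
  fixes Q :: "real^'k^'k"
  assumes sym: "transpose Q = Q"
  shows "GDERIV (quadratic_cost Q) u :> Q *v u"
proof -
  have "((*v) Q has_derivative (*v) Q) (at u)"
    by (simp add: bounded_linear_imp_has_derivative)
  then have "(quadratic_cost Q has_derivative
      (\<lambda>h. 1 / 2 * (u \<bullet> (Q *v h) + h \<bullet> (Q *v u)))) (at u)"
    unfolding quadratic_cost_def by (intro derivative_intros)
  then show ?thesis
    unfolding gderiv_def using inner_matrix_commute[OF sym, of u] by simp
qed

lemma GDERIV_imp_eq: "GDERIV f x :> a \<Longrightarrow> GDERIV f x :> b \<Longrightarrow> a = b"
  unfolding gderiv_def
  by (metis has_derivative_unique vector_eq_rdot inner_commute)

lemma optimality_condition_iff_kkt_pair:
  fixes Q :: "real^'k^'k" and B :: "real^'k^'n"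
  assumes "transpose Q = Q"
  shows "optimality_condition (quadratic_cost Q) B e xbar u \<longleftrightarrow> (\<exists>\<mu>. kkt_pair Q B e xbar u \<mu>)"
proof -
  have "GDERIV (quadratic_cost Q) u :> g \<longleftrightarrow> g = Q *v u" for g
    using GDERIV_quadratic_cost[OF assms, of u] GDERIV_imp_eq by blast
  then show ?thesis
    by (auto simp: optimality_condition_def kkt_pair_def vector_matrix_mult_eq_sum_rows
        less_eq_vec_def[of 0])
qed

section \<open>Convexity and minimizers of the augmented cost\<close>

text \<open>
  The coefficients of the rows of \<open>B\<close> in the gradient of the augmented cost at \<open>u\<close>.
\<close>
definition effective_weights ::
  "real^'n \<Rightarrow> real^'k^'n \<Rightarrow> real^'n \<Rightarrow> real^'n \<Rightarrow> real^'n \<Rightarrow> real^'k \<Rightarrow> real^'n" where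
  "effective_weights \<beta> B e xbar \<alpha> u =
     (\<chi> i. \<alpha> $ i * exp (\<beta> $ i * (row i B \<bullet> u + e $ i - xbar $ i)))"

lemma GDERIV_augmented_cost:
  fixes Q :: "real^'k^'k" and B :: "real^'k^'n"
  assumes sym: "transpose Q = Q" and \<beta>: "\<And>i. 0 < \<beta> $ i"
  shows "GDERIV (augmented_cost (quadratic_cost Q) \<beta> B e xbar \<alpha>) u :>
    Q *v u + effective_weights \<beta> B e xbar \<alpha> u v* B"
proof -
  have q: "(quadratic_cost Q has_derivative (\<lambda>h. h \<bullet> (Q *v u))) (at u)"
    using GDERIV_quadratic_cost[OF sym] by (simp add: gderiv_def)
  have b: "\<beta> $ i \<noteq> 0" for i using \<beta>[of i] by simp
  show ?thesis
    unfolding gderiv_def augmented_cost_def vector_matrix_mult_eq_sum_rows effective_weights_def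
    by (rule has_derivative_eq_rhs, (rule derivative_intros q)+)
      (auto simp: fun_eq_iff inner_add_right inner_sum_right b inner_commute mult_ac
        intro!: sum.cong)
qed

text \<open>
  The quadratic part contributes the term in \<open>m\<close>, since its second-order expansion is exact; each
  penalty term lies above its tangent by \<open>1 + t \<le> exp t\<close>. Both strong convexity and
  the minimality of stationary points are read off from this one inequality.
\<close>
lemma augmented_cost_above_tangent:
  fixes Q :: "real^'k^'k" and B :: "real^'k^'n"
  assumes sym: "transpose Q = Q" and \<beta>: "\<And>i. 0 < \<beta> $ i" and \<alpha>: "0 \<le> \<alpha>"
    and m: "\<And>x. m * (norm x)\<^sup>2 \<le> x \<bullet> (Q *v x)"
  shows "augmented_cost (quadratic_cost Q) \<beta> B e xbar \<alpha> u
      + (Q *v u + effective_weights \<beta> B e xbar \<alpha> u v* B) \<bullet> (y - u)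
      + m / 2 * (norm (y - u))\<^sup>2
    \<le> augmented_cost (quadratic_cost Q) \<beta> B e xbar \<alpha> y"
proof -
  define s where "s i x = \<beta> $ i * (row i B \<bullet> x + e $ i - xbar $ i)" for i x
  have exp_bound: "\<alpha> $ i / \<beta> $ i * exp (s i u) + \<alpha> $ i * exp (s i u) * (row i B \<bullet> (y - u))
      \<le> \<alpha> $ i / \<beta> $ i * exp (s i y)" for i
  proof -
    have "exp (s i u) * (1 + (s i y - s i u)) \<le> exp (s i u) * exp (s i y - s i u)"
      by (intro mult_left_mono exp_ge_add_one_self) auto
    also have "\<dots> = exp (s i y)" by (simp flip: exp_add)
    finally have "\<alpha> $ i / \<beta> $ i * (exp (s i u) * (1 + (s i y - s i u)))
        \<le> \<alpha> $ i / \<beta> $ i * exp (s i y)"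
      using \<alpha> \<beta>[of i] by (intro mult_left_mono) (auto simp: less_eq_vec_def)
    moreover have "s i y - s i u = \<beta> $ i * (row i B \<bullet> (y - u))"
      by (simp add: s_def inner_diff_right algebra_simps)
    ultimately show ?thesis using \<beta>[of i] by (simp add: field_simps)
  qed
  have "quadratic_cost Q y
      = quadratic_cost Q u + (Q *v u) \<bullet> (y - u) + 1 / 2 * ((y - u) \<bullet> (Q *v (y - u)))"
    using quadratic_cost_expansion[OF sym, of u "y - u"] by simp
  then have "quadratic_cost Q u + (Q *v u) \<bullet> (y - u) + m / 2 * (norm (y - u))\<^sup>2
      \<le> quadratic_cost Q y"
    using m[of "y - u"] by simp
  moreover have "(\<Sum>i\<in>UNIV. \<alpha> $ i / \<beta> $ i * exp (s i u))
      + (effective_weights \<beta> B e xbar \<alpha> u v* B) \<bullet> (y - u)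
      \<le> (\<Sum>i\<in>UNIV. \<alpha> $ i / \<beta> $ i * exp (s i y))"
    unfolding vector_matrix_mult_eq_sum_rows effective_weights_def inner_sum_left sum.distrib[symmetric]
    using exp_bound by (intro sum_mono) (simp add: s_def)
  ultimately show ?thesis
    by (simp add: augmented_cost_def s_def inner_add_left)
qed

text \<open>
  Weighting the quadratic lower bounds with base point \<open>z = t x + (1 - t) y\<close> by \<open>t\<close> at
  \<open>x\<close> and by \<open>1 - t\<close> at \<open>y\<close> cancels the linear terms; the quadratic ones add up because
  \<open>t (1 - t)\<^sup>2 + (1 - t) t\<^sup>2 = t (1 - t)\<close>.
\<close>
lemma strongly_convex_if_above_tangents:
  fixes f :: "'a::real_inner \<Rightarrow> real"
  assumes "0 < m" and tan: "\<And>u y. f u + g u \<bullet> (y - u) + m / 2 * (norm (y - u))\<^sup>2 \<le> f y"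
  shows "strongly_convex f"
  unfolding strongly_convex_def
proof (intro exI[of _ m] conjI allI ballI)
  fix x y :: 'a and t :: real
  assume t: "t \<in> {0..1}"
  define z where "z = t *\<^sub>R x + (1 - t) *\<^sub>R y"
  have x: "x - z = (1 - t) *\<^sub>R (x - y)" and y: "y - z = (- t) *\<^sub>R (x - y)"
    by (simp_all add: z_def algebra_simps)
  have "f z + (1 - t) * (g z \<bullet> (x - y)) + m / 2 * ((1 - t)\<^sup>2 * (norm (x - y))\<^sup>2) \<le> f x"
    using tan[of z x] by (simp add: x power_mult_distrib)
  then have fx: "t * (f z + (1 - t) * (g z \<bullet> (x - y)) + m / 2 * ((1 - t)\<^sup>2 * (norm (x - y))\<^sup>2))
      \<le> t * f x"
    using t by (intro mult_left_mono) auto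
  have "f z - t * (g z \<bullet> (x - y)) + m / 2 * (t\<^sup>2 * (norm (x - y))\<^sup>2) \<le> f y"
    using tan[of z y] by (simp add: y power_mult_distrib del: scaleR_minus_left)
  then have fy: "(1 - t) * (f z - t * (g z \<bullet> (x - y)) + m / 2 * (t\<^sup>2 * (norm (x - y))\<^sup>2))
      \<le> (1 - t) * f y"
    using t by (intro mult_left_mono) auto
  have "t * (f z + (1 - t) * (g z \<bullet> (x - y)) + m / 2 * ((1 - t)\<^sup>2 * (norm (x - y))\<^sup>2))
      + (1 - t) * (f z - t * (g z \<bullet> (x - y)) + m / 2 * (t\<^sup>2 * (norm (x - y))\<^sup>2))
    = f z + m / 2 * t * (1 - t) * (norm (x - y))\<^sup>2"
    by (simp add: field_simps power2_eq_square)
  with fx fy show "f (t *\<^sub>R x + (1 - t) *\<^sub>R y)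
      \<le> t * f x + (1 - t) * f y - m / 2 * t * (1 - t) * (norm (x - y))\<^sup>2"
    by (simp add: z_def)
qed (use assms in auto)

lemma strongly_convex_augmented_cost:
  fixes Q :: "real^'k^'k" and B :: "real^'k^'n"
  assumes "transpose Q = Q" "positive_definite Q" "\<And>i. 0 < \<beta> $ i" "0 \<le> \<alpha>"
  shows "strongly_convex (augmented_cost (quadratic_cost Q) \<beta> B e xbar \<alpha>)"
proof -
  obtain m where m: "0 < m" "\<And>x. m * (norm x)\<^sup>2 \<le> x \<bullet> (Q *v x)"
    using positive_definite_coercive assms(2) by metis
  show ?thesis
    using m(1) augmented_cost_above_tangent[OF assms(1,3,4) m(2)]
    by (rule strongly_convex_if_above_tangents)
qed

lemma augmented_cost_minimizer_stationary:
  fixes Q :: "real^'k^'k" and B :: "real^'k^'n"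
  assumes "transpose Q = Q" "\<And>i. 0 < \<beta> $ i"
    and min: "is_arg_min (augmented_cost (quadratic_cost Q) \<beta> B e xbar \<alpha>) (\<lambda>_. True) u"
  shows "Q *v u + effective_weights \<beta> B e xbar \<alpha> u v* B = 0" (is "?g = 0")
proof -
  let ?f = "augmented_cost (quadratic_cost Q) \<beta> B e xbar \<alpha>"
  have "(?f has_derivative (\<lambda>h. h \<bullet> ?g)) (at u)"
    using GDERIV_augmented_cost[OF assms(1,2)] by (simp add: gderiv_def)
  moreover have "\<forall>y\<in>UNIV. ?f u \<le> ?f y" using min by (auto simp: is_arg_min_linorder)
  ultimately have "(\<lambda>h. h \<bullet> ?g) = (\<lambda>h. 0)"
    using differential_zero_maxmin[of u UNIV ?f] by auto
  then show ?thesis by (metis inner_eq_zero_iff)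
qed

section \<open>Exact weights are multipliers\<close>

text \<open>
  On the active set the exponential factor is \<open>1\<close>, off it the multiplier is \<open>0\<close>: at the primal
  point of a pair the penalty exerts exactly the force of the multipliers.
\<close>
lemma effective_weights_kkt_pair:
  assumes "kkt_pair Q B e xbar u \<alpha>"
  shows "effective_weights \<beta> B e xbar \<alpha> u = \<alpha>"
proof -
  have "effective_weights \<beta> B e xbar \<alpha> u $ i = \<alpha> $ i" for i
    using assms by (cases "i \<in> active_set B e xbar u")
      (auto simp: effective_weights_def kkt_pair_def active_set_def)
  then show ?thesis by (simp add: vec_eq_iff)
qed

text \<open>
  With the multipliers as weights, the gradient of the augmented cost at \<open>u\<close> is that of the
  Lagrangian and vanishes, so the cost grows at least quadratically away from \<open>u\<close>.
\<close>
lemma kkt_pair_minimizer: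
  fixes Q :: "real^'k^'k" and B :: "real^'k^'n"
  assumes sym: "transpose Q = Q" and pd: "positive_definite Q" and \<beta>: "\<And>i. 0 < \<beta> $ i"
    and k: "kkt_pair Q B e xbar u \<alpha>"
  shows "is_arg_min (augmented_cost (quadratic_cost Q) \<beta> B e xbar \<alpha>) (\<lambda>_. True) y \<longleftrightarrow> y = u"
proof -
  let ?f = "augmented_cost (quadratic_cost Q) \<beta> B e xbar \<alpha>"
  obtain m where m: "0 < m" "\<And>x. m * (norm x)\<^sup>2 \<le> x \<bullet> (Q *v x)"
    using positive_definite_coercive pd by metis
  have "0 \<le> \<alpha>" and "Q *v u + effective_weights \<beta> B e xbar \<alpha> u v* B = 0"
    using k by (auto simp: kkt_pair_def effective_weights_kkt_pair[OF k])
  then have growth: "?f u + m / 2 * (norm (y - u))\<^sup>2 \<le> ?f y" for y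
    using augmented_cost_above_tangent[OF sym \<beta> _ m(2), of \<alpha> B e xbar u y] by simp
  have le: "?f u \<le> ?f y" for y
    using growth[of y] m(1) by (smt (verit) half_gt_zero mult_nonneg_nonneg zero_le_power2)
  have "y = u" if "?f y \<le> ?f u"
  proof -
    have "m / 2 * (norm (y - u))\<^sup>2 \<le> 0" using growth[of y] that by simp
    then show ?thesis using m(1) by (simp add: mult_le_0_iff)
  qed
  then show ?thesis using le by (auto simp: is_arg_min_linorder)
qed

text \<open>
  Left to right, row independence turns equality of the two gradients into
  equality of effective weights and multipliers, from which \<open>\<alpha>\<close> is recovered componentwise.
\<close>
lemma exact_weights_iff_kkt_pair:
  fixes Q :: "real^'k^'k" and B :: "real^'k^'n"
  assumes sym: "transpose Q = Q" and pd: "positive_definite Q" and \<beta>: "\<And>i. 0 < \<beta> $ i"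
    and ind: "\<And>a. a v* B = 0 \<Longrightarrow> a = 0"
  shows "exact_weights (quadratic_cost Q) \<beta> B e xbar \<alpha> \<longleftrightarrow> (\<exists>u. kkt_pair Q B e xbar u \<alpha>)"
proof
  let ?f = "augmented_cost (quadratic_cost Q) \<beta> B e xbar \<alpha>"
  assume "exact_weights (quadratic_cost Q) \<beta> B e xbar \<alpha>"
  then obtain u \<mu> where u: "is_arg_min ?f (\<lambda>_. True) u" and k: "kkt_pair Q B e xbar u \<mu>"
    unfolding exact_weights_def optimality_condition_iff_kkt_pair[OF sym] by blast
  let ?w = "effective_weights \<beta> B e xbar \<alpha> u"
  have "Q *v u + ?w v* B = 0"
    using augmented_cost_minimizer_stationary[OF sym \<beta> u] .
  moreover have "Q *v u + \<mu> v* B = 0" using k by (simp add: kkt_pair_def)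
  ultimately have "?w = \<mu>"
    using stationary_pairs_coincide[OF pd ind, where u = u and u' = u and a = ?w and a' = \<mu>] by simp
  moreover have "\<alpha> $ i = \<mu> $ i" if "?w $ i = \<mu> $ i" for i
    using that k by (cases "i \<in> active_set B e xbar u")
      (auto simp: effective_weights_def kkt_pair_def active_set_def)
  ultimately have "\<alpha> = \<mu>" by (simp add: vec_eq_iff)
  with k show "\<exists>u. kkt_pair Q B e xbar u \<alpha>" by blast
next
  assume "\<exists>u. kkt_pair Q B e xbar u \<alpha>"
  then obtain u where k: "kkt_pair Q B e xbar u \<alpha>" ..
  then have "0 \<le> \<alpha>" by (simp add: kkt_pair_def)
  then show "exact_weights (quadratic_cost Q) \<beta> B e xbar \<alpha>"
    unfolding exact_weights_def optimality_condition_iff_kkt_pair[OF sym]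
    using k kkt_pair_minimizer[OF sym pd \<beta> k] strongly_convex_augmented_cost[OF sym pd \<beta>]
    by (auto simp: less_eq_vec_def)
qed

text \<open>
  The components indexed by \<open>Inl\<close> of the combination of the rows of \<open>[R X]\<close> with coefficients
  \<open>a\<close> form \<open>R\<^sup>T a = R a\<close>, which is zero only for \<open>a = 0\<close>.
\<close>
lemma hcat_rows_independent:
  fixes R X :: "real^'n^'n"
  assumes sym: "transpose R = R" and pd: "positive_definite R"
    and "a v* hcat R X = 0"
  shows "a = 0"
proof -
  have "(a v* R) $ j = (a v* hcat R X) $ Inl j" for j
    by (simp add: vector_matrix_mult_def hcat_def)
  then have "a v* R = 0" using assms by (simp add: vec_eq_iff)
  then have "R *v a = 0" using sym by (metis transpose_matrix_vector)
  then show ?thesis using pd by (intro positive_definite_eq_0) auto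
qed

theorem theorem1:
  fixes R X :: "real^'n^'n"
    and Q :: "real^('n + 'n)^('n + 'n)"
    and \<beta> e xbar :: "real^'n"
    and B :: "real^('n + 'n)^'n"
    and c :: "real^('n + 'n) \<Rightarrow> real"
  assumes "transpose R = R" "positive_definite R" "\<And>i j. 0 < R $ i $ j"
    and "transpose X = X" "positive_definite X" "\<And>i j. 0 < X $ i $ j"
    and "transpose Q = Q" "positive_definite Q"
    and "\<And>i. 0 < \<beta> $ i"
    and "B = hcat R X"
    and "c = quadratic_cost Q"
  shows "(\<exists>!\<alpha>. exact_weights c \<beta> B e xbar \<alpha>) \<and>
    (\<forall>\<alpha>. exact_weights c \<beta> B e xbar \<alpha> \<longrightarrow>
      (\<exists>ustar.
        (\<forall>u. is_arg_min (augmented_cost c \<beta> B e xbar \<alpha>) (\<lambda>_. True) u \<longleftrightarrow> u = ustar) \<and>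
        (let A = active_set B e xbar ustar in
          (\<exists>v. saddle_point_system Q B e xbar A v \<alpha> \<and>
            (\<forall>v' a'. saddle_point_system Q B e xbar A v' a' \<longrightarrow>
               v' = v \<and> (\<forall>i\<in>A. a' $ i = \<alpha> $ i))) \<and>
          (\<forall>j. j \<notin> A \<longrightarrow> \<alpha> $ j = 0))))"
proof -
  note Q = assms(7,8) and \<beta> = assms(9) and c = assms(11)
  have ind: "a = 0" if "a v* B = 0" for a
    using that hcat_rows_independent assms(1,2,10) by blast
  note exact_iff = exact_weights_iff_kkt_pair[OF Q \<beta> ind, folded c]
  obtain u \<mu> where k: "kkt_pair Q B e xbar u \<mu>"
    using kkt_pair_exists[OF Q ind] by metis
  have weights: "exact_weights c \<beta> B e xbar \<alpha> \<longleftrightarrow> \<alpha> = \<mu>" for \<alpha>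
    using exact_iff k kkt_pair_unique[OF Q(2) ind k] by blast
  have "\<mu> $ j = 0" if "j \<notin> active_set B e xbar u" for j
    using k that by (simp add: kkt_pair_def)
  then show ?thesis
    unfolding weights Let_def unfolding c
    using kkt_pair_minimizer[OF Q \<beta> k] kkt_pair_saddle_point[OF Q(2) ind k refl] by auto
qed

end
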